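(* Let $\mathscr G$ be an ample groupoid and $K$ a commutative ring with unit. The center of $K\mathscr G$ is the set of class functions.
   Context: A groupoid is a small category with all arrows invertible; objects are identified with units, $\mathscr G^0$ is the unit space, $d(g)=g^{-1}g$, $r(g)=gg^{-1}$, and $gh$ is defined iff $d(g)=r(h)$. "Compact" includes Hausdorff. An étale groupoid is a topological groupoid, locally compact (not necessarily Hausdorff), with $\mathscr G^0$ locally compact Hausdorff and $d\colon\mathscr G\to\mathscr G^0$ a local homeomorphism. A slice is an open $U\subseteq\mathscr G$ with $d|_U$, $r|_U$ injective. $\mathscr G$ is ample if it is étale and the compact slices form a basis of its topology. Give $K$ the discrete topology. $K\mathscr G$ is the $K$-module of functions $\mathscr G\to K$ spanned by those $f$ for which there is an open Hausdorff subspace $V$ such that $f$ vanishes outside $V$ and $f|_V$ is continuous with compact support. It is a $K$-algebra under convolution $f\ast g(x)=\sum_{y\in d^{-1}(d(x))}f(xy^{-1})g(y)$. An $f\in K\mathscr G$ is a class function if (1) $f(x)\neq0$ implies $d(x)=r(x)$; and (2) $d(x)=r(x)=d(z)$ implies $f(zxz^{-1})=f(x)$. *)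

theory Defs
  imports "HOL-Analysis.Analysis"
begin

text \<open>
  A groupoid is encoded by its set of arrows alone: objects are identified with unit arrows. The
  arrows are the points of the topology; composition is a total function whose values are
  only meaningful on arrows \<open>g, h\<close> with \<open>dm g = rg h\<close>.
\<close>

record 'g groupoid_data =
  arrtop :: "'g topology"
  dm :: "'g \<Rightarrow> 'g" ("\<d>\<index>")
  rg :: "'g \<Rightarrow> 'g" ("\<r>\<index>")
  cmp :: "'g \<Rightarrow> 'g \<Rightarrow> 'g" (infixl "\<cdot>\<index>" 70)
  ginv :: "'g \<Rightarrow> 'g" ("\<i>\<index>")

definition arrows :: "'g groupoid_data \<Rightarrow> 'g set" where
  "arrows G = topspace (arrtop G)"

definition unit_arrows :: "'g groupoid_data \<Rightarrow> 'g set" where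
  "unit_arrows G = dm G ` arrows G"

definition composable :: "'g groupoid_data \<Rightarrow> ('g \<times> 'g) set" where
  "composable G = {(g, h). g \<in> arrows G \<and> h \<in> arrows G \<and> dm G g = rg G h}"

locale groupoid =
  fixes G :: "'g groupoid_data" (structure)
  assumes dm_closed: "g \<in> arrows G \<Longrightarrow> \<d> g \<in> arrows G"
    and rg_closed: "g \<in> arrows G \<Longrightarrow> \<r> g \<in> arrows G"
    and dm_dm: "g \<in> arrows G \<Longrightarrow> \<d> (\<d> g) = \<d> g"
    and rg_dm: "g \<in> arrows G \<Longrightarrow> \<r> (\<d> g) = \<d> g"
    and dm_rg: "g \<in> arrows G \<Longrightarrow> \<d> (\<r> g) = \<r> g"
    and rg_rg: "g \<in> arrows G \<Longrightarrow> \<r> (\<r> g) = \<r> g"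
    and cmp_closed: "(g, h) \<in> composable G \<Longrightarrow> g \<cdot> h \<in> arrows G"
    and dm_cmp: "(g, h) \<in> composable G \<Longrightarrow> \<d> (g \<cdot> h) = \<d> h"
    and rg_cmp: "(g, h) \<in> composable G \<Longrightarrow> \<r> (g \<cdot> h) = \<r> g"
    and cmp_assoc: "(g, h) \<in> composable G \<Longrightarrow> (h, k) \<in> composable G
                      \<Longrightarrow> (g \<cdot> h) \<cdot> k = g \<cdot> (h \<cdot> k)"
    and cmp_dm: "g \<in> arrows G \<Longrightarrow> g \<cdot> \<d> g = g"
    and rg_cmp_self: "g \<in> arrows G \<Longrightarrow> \<r> g \<cdot> g = g"
    and inv_closed: "g \<in> arrows G \<Longrightarrow> \<i> g \<in> arrows G"
    and dm_inv: "g \<in> arrows G \<Longrightarrow> \<d> (\<i> g) = \<r> g"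
    and rg_inv: "g \<in> arrows G \<Longrightarrow> \<r> (\<i> g) = \<d> g"
    and inv_cmp: "g \<in> arrows G \<Longrightarrow> \<i> g \<cdot> g = \<d> g"
    and cmp_inv: "g \<in> arrows G \<Longrightarrow> g \<cdot> \<i> g = \<r> g"

locale topological_groupoid = groupoid +
  assumes continuous_cmp:
      "continuous_map (subtopology (prod_topology (arrtop G) (arrtop G)) (composable G)) (arrtop G)
         (\<lambda>(g, h). g \<cdot> h)"
    and continuous_inv: "continuous_map (arrtop G) (arrtop G) (ginv G)"

definition local_homeomorphism_map :: "'a topology \<Rightarrow> 'b topology \<Rightarrow> ('a \<Rightarrow> 'b) \<Rightarrow> bool" where
  "local_homeomorphism_map X Y f \<longleftrightarrow>
     (\<forall>x \<in> topspace X. \<exists>U. openin X U \<and> x \<in> U \<and> openin Y (f ` U) \<and>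
        homeomorphic_map (subtopology X U) (subtopology Y (f ` U)) f)"

definition unit_space :: "'g groupoid_data \<Rightarrow> 'g topology" where
  "unit_space G = subtopology (arrtop G) (unit_arrows G)"

locale etale_groupoid = topological_groupoid +
  assumes locally_compact: "locally_compact_space (arrtop G)"
    and unit_space_locally_compact: "locally_compact_space (unit_space G)"
    and unit_space_Hausdorff: "Hausdorff_space (unit_space G)"
    and dm_local_homeomorphism: "local_homeomorphism_map (arrtop G) (unit_space G) (dm G)"

definition slice :: "'g groupoid_data \<Rightarrow> 'g set \<Rightarrow> bool" where
  "slice G U \<longleftrightarrow> openin (arrtop G) U \<and> inj_on (dm G) U \<and> inj_on (rg G) U"

text \<open>Compactness is understood to include the Hausdorff property.\<close>

definition compact_slice :: "'g groupoid_data \<Rightarrow> 'g set \<Rightarrow> bool" where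
  "compact_slice G U \<longleftrightarrow>
     slice G U \<and> compactin (arrtop G) U \<and> Hausdorff_space (subtopology (arrtop G) U)"

locale ample_groupoid = etale_groupoid +
  assumes compact_slices_basis: "openin (arrtop G) = arbitrary union_of (compact_slice G)"

text \<open>
  Functions on the groupoid are represented by functions on the ambient type vanishing off
  \<open>arrows G\<close>. The coefficient sort is that of commutative unital rings, where
  \<open>0 = 1\<close> is allowed (unlike in the class \<open>comm_ring_1\<close>).
\<close>

definition algebra_generators ::
    "'g groupoid_data \<Rightarrow> ('g \<Rightarrow> 'k::{comm_ring,comm_monoid_mult}) set" where
  "algebra_generators G = {f. \<exists>V. openin (arrtop G) V \<and> Hausdorff_space (subtopology (arrtop G) V) \<and>
     (\<forall>x. x \<notin> V \<longrightarrow> f x = 0) \<and>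
     continuous_map (subtopology (arrtop G) V) (discrete_topology UNIV) f \<and>
     compactin (subtopology (arrtop G) V) (subtopology (arrtop G) V closure_of {x \<in> V. f x \<noteq> 0})}"

definition groupoid_algebra ::
    "'g groupoid_data \<Rightarrow> ('g \<Rightarrow> 'k::{comm_ring,comm_monoid_mult}) set" where
  "groupoid_algebra G = {f. \<exists>(n::nat) c h. (\<forall>i<n. h i \<in> algebra_generators G) \<and>
     f = (\<lambda>x. \<Sum>i<n. c i * h i x)}"

text \<open>
  Fibres of \<open>dm\<close> may be infinite, so the sum is taken with \<open>sum'\<close>, which
  sums over the nonzero terms whenever there are finitely many of them.
\<close>

definition convolution ::
    "'g groupoid_data \<Rightarrow> ('g \<Rightarrow> 'k::{comm_ring,comm_monoid_mult}) \<Rightarrow> ('g \<Rightarrow> 'k) \<Rightarrow> 'g \<Rightarrow> 'k" where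
  "convolution G f g x =
     (if x \<in> arrows G
      then sum' (\<lambda>y. f (cmp G x (ginv G y)) * g y) {y \<in> arrows G. dm G y = dm G x}
      else 0)"

definition algebra_center ::
    "'g groupoid_data \<Rightarrow> ('g \<Rightarrow> 'k::{comm_ring,comm_monoid_mult}) set" where
  "algebra_center G = {f \<in> groupoid_algebra G.
     \<forall>g \<in> groupoid_algebra G. convolution G f g = convolution G g f}"

definition class_functions ::
    "'g groupoid_data \<Rightarrow> ('g \<Rightarrow> 'k::{comm_ring,comm_monoid_mult}) set" where
  "class_functions G = {f \<in> groupoid_algebra G.
     (\<forall>x \<in> arrows G. f x \<noteq> 0 \<longrightarrow> dm G x = rg G x) \<and>
     (\<forall>x \<in> arrows G. \<forall>z \<in> arrows G. dm G x = rg G x \<and> rg G x = dm G z \<longrightarrow>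
        f (cmp G (cmp G z x) (ginv G z)) = f x)}"

end

theory Submission
  imports Defs
begin

text \<open>
  Convolving with indicator functions \<open>1\<^sub>U\<close> of compact slices detects the two conditions. If
  \<open>U\<close> consists of units, contains \<open>d(x)\<close> and misses \<open>r(x)\<close>, then \<open>f * 1\<^sub>U\<close> and \<open>1\<^sub>U * f\<close> take the
  values \<open>f(x)\<close> and \<open>0\<close> at \<open>x\<close>. If \<open>U\<close> contains \<open>z\<close>, they take the values \<open>f(zxz\<inverse>)\<close> and
  \<open>f(x)\<close> at \<open>zx\<close>. Conversely, for a class function \<open>f\<close> the substitution \<open>z = y\<inverse>x\<close> turns the sum
  defining \<open>(f * g)(x)\<close> into the one defining \<open>(g * f)(x)\<close>.
\<close>

section \<open>Sums over possibly infinite index sets\<close>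

lemma sum'_eq_single:
  fixes p :: "'i \<Rightarrow> 'k::comm_monoid_add"
  assumes "a \<in> I" "\<And>y. y \<in> I \<Longrightarrow> y \<noteq> a \<Longrightarrow> p y = 0"
  shows "sum' p I = p a"
proof -
  have "sum' p I = sum' p {a}"
    by (rule sum.mono_neutral_right') (use assms in auto)
  then show ?thesis by (simp add: sum.eq_sum)
qed

text \<open>The bijection restricts to the sets of indices with nonzero terms. Either both of these
  are finite and the ordinary reindexing applies, or both are infinite and each side has the default
  value 0.\<close>

lemma sum'_reindex_bij_betw:
  fixes p :: "'i \<Rightarrow> 'k::comm_monoid_add"
  assumes "bij_betw h S T"
  shows "sum' (\<lambda>x. p (h x)) S = sum' p T"
proof -
  have "bij_betw h {x \<in> S. p (h x) \<noteq> 0} {y \<in> T. p y \<noteq> 0}"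
    using assms by (auto simp: bij_betw_def inj_on_def)
  then show ?thesis
    using bij_betw_finite sum.reindex_bij_betw by (fastforce simp: sum.G_def)
qed

lemma indicator_compact_slice_in_groupoid_algebra:
  assumes "compact_slice G U"
  shows "(\<lambda>x. if x \<in> U then 1 else 0) \<in>
           (groupoid_algebra G :: ('g \<Rightarrow> 'k::{comm_ring,comm_monoid_mult}) set)"
    (is "?f \<in> _")
proof -
  let ?T = "subtopology (arrtop G) U"
  have U: "openin (arrtop G) U" "compactin (arrtop G) U" "Hausdorff_space ?T"
    using assms by (auto simp: compact_slice_def slice_def)
  have top: "topspace ?T = U"
    using openin_subset[OF U(1)] by auto
  have cont: "continuous_map ?T (discrete_topology UNIV) ?f"
    by (rule continuous_map_eq[where f = "\<lambda>_. 1"]) (auto simp: top)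
  \<comment> \<open>If 0 = 1 in the ring, the support is empty instead of \<open>U\<close>. Treating
    its closure as a closed subset of the compact set \<open>U\<close> covers both cases.\<close>
  have "compactin ?T (?T closure_of {x \<in> U. ?f x \<noteq> 0})"
  proof (rule closed_compactin)
    show "compactin ?T U" using U(2) by (simp add: compactin_subtopology)
    show "?T closure_of {x \<in> U. ?f x \<noteq> 0} \<subseteq> U"
      using closure_of_subset_topspace[of ?T] top by auto
  qed simp
  then have "?f \<in> algebra_generators G"
    unfolding algebra_generators_def using U cont by (intro CollectI exI[of _ U]) auto
  then show ?thesis
    unfolding groupoid_algebra_def
    by (intro CollectI exI[of _ "1::nat"] exI[of _ "\<lambda>_. 1"] exI[of _ "\<lambda>_. ?f"]) auto
qed

section \<open>Cancellation and division in a groupoid\<close>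

context groupoid
begin

lemma cancel_left:
  assumes "(g, h) \<in> composable G"
  shows "\<i> g \<cdot> (g \<cdot> h) = h"
proof -
  have g: "g \<in> arrows G" "h \<in> arrows G" "\<d> g = \<r> h"
    using assms by (auto simp: composable_def)
  then have "\<i> g \<cdot> (g \<cdot> h) = (\<i> g \<cdot> g) \<cdot> h"
    by (intro cmp_assoc[symmetric]) (auto simp: composable_def dm_inv inv_closed)
  then show ?thesis using g by (simp add: inv_cmp rg_cmp_self)
qed

lemma cancel_right:
  assumes "(g, h) \<in> composable G"
  shows "(g \<cdot> h) \<cdot> \<i> h = g"
proof -
  have g: "g \<in> arrows G" "h \<in> arrows G" "\<d> g = \<r> h"
    using assms by (auto simp: composable_def)
  then have "(g \<cdot> h) \<cdot> \<i> h = g \<cdot> (h \<cdot> \<i> h)"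
    by (intro cmp_assoc) (auto simp: composable_def rg_inv inv_closed)
  then show ?thesis using g by (metis cmp_inv cmp_dm)
qed

lemma inv_inv:
  assumes "g \<in> arrows G"
  shows "\<i> (\<i> g) = g"
proof -
  have "\<i> (\<i> g) \<cdot> (\<i> g \<cdot> g) = g"
    by (rule cancel_left) (simp add: assms composable_def dm_inv inv_closed)
  then show ?thesis
    by (metis assms cmp_dm dm_inv inv_closed inv_cmp rg_inv)
qed

lemma cancel_inv_right:
  assumes "g \<in> arrows G" "h \<in> arrows G" "\<d> g = \<d> h"
  shows "(g \<cdot> \<i> h) \<cdot> h = g"
  using cancel_right[of g "\<i> h"] assms by (simp add: composable_def inv_inv inv_closed rg_inv)

lemma div_closed:
  assumes "g \<in> arrows G" "h \<in> arrows G" "\<d> g = \<d> h"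
  shows "g \<cdot> \<i> h \<in> arrows G" "\<d> (g \<cdot> \<i> h) = \<r> h" "\<r> (g \<cdot> \<i> h) = \<r> g"
proof -
  have "(g, \<i> h) \<in> composable G"
    using assms by (simp add: composable_def inv_closed rg_inv)
  then show "g \<cdot> \<i> h \<in> arrows G" "\<d> (g \<cdot> \<i> h) = \<r> h" "\<r> (g \<cdot> \<i> h) = \<r> g"
    using assms cmp_closed dm_cmp rg_cmp dm_inv by auto
qed

text \<open>Together with \<open>div_ldiv_cancel\<close>, this makes the maps sending y to y^{-1}x
  and z to xz^{-1} mutually inverse for a fixed arrow x.\<close>

lemma div_div_cancel:
  assumes "g \<in> arrows G" "h \<in> arrows G" "\<d> g = \<d> h"
  shows "\<i> (g \<cdot> \<i> h) \<cdot> g = h"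
proof -
  have "\<i> (g \<cdot> \<i> h) \<cdot> ((g \<cdot> \<i> h) \<cdot> h) = h"
    by (rule cancel_left) (use assms div_closed in \<open>simp add: composable_def\<close>)
  then show ?thesis using assms by (simp add: cancel_inv_right)
qed

lemma ldiv_closed:
  assumes "g \<in> arrows G" "h \<in> arrows G" "\<r> g = \<r> h"
  shows "\<i> h \<cdot> g \<in> arrows G" "\<d> (\<i> h \<cdot> g) = \<d> g" "\<r> (\<i> h \<cdot> g) = \<d> h"
proof -
  have "(\<i> h, g) \<in> composable G"
    using assms by (simp add: composable_def inv_closed dm_inv)
  then show "\<i> h \<cdot> g \<in> arrows G" "\<d> (\<i> h \<cdot> g) = \<d> g" "\<r> (\<i> h \<cdot> g) = \<d> h"
    using assms cmp_closed dm_cmp rg_cmp rg_inv by auto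
qed

lemma cancel_inv_left:
  assumes "g \<in> arrows G" "h \<in> arrows G" "\<r> g = \<r> h"
  shows "h \<cdot> (\<i> h \<cdot> g) = g"
  using cancel_left[of "\<i> h" g] assms by (simp add: composable_def inv_inv inv_closed dm_inv)

lemma div_ldiv_cancel:
  assumes "g \<in> arrows G" "h \<in> arrows G" "\<r> g = \<r> h"
  shows "g \<cdot> \<i> (\<i> h \<cdot> g) = h"
proof -
  have "(h \<cdot> (\<i> h \<cdot> g)) \<cdot> \<i> (\<i> h \<cdot> g) = h"
    by (rule cancel_right) (use assms ldiv_closed in \<open>simp add: composable_def\<close>)
  then show ?thesis using assms by (simp add: cancel_inv_left)
qed

section \<open>Class functions commute under convolution\<close>

lemma convolution_class_function_commute:
  fixes f g :: "'g \<Rightarrow> 'k::{comm_ring,comm_monoid_mult}"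
  assumes f: "f \<in> class_functions G"
  shows "convolution G f g = convolution G g f"
proof
  fix x
  show "convolution G f g x = convolution G g f x"
  proof (cases "x \<in> arrows G")
    case x: True
    \<comment> \<open>\<open>?D\<close> indexes both convolution sums at \<open>x\<close>,
      \<open>?P\<close> consists of the arrows parallel to \<open>x\<close>, and \<open>?I\<close>
      is the isotropy group at d(x).\<close>
    let ?D = "{y \<in> arrows G. \<d> y = \<d> x}"
    let ?P = "{y \<in> arrows G. \<d> y = \<d> x \<and> \<r> y = \<r> x}"
    let ?I = "{z \<in> arrows G. \<d> z = \<d> x \<and> \<r> z = \<d> x}"
    have iso: "f w = 0" if "w \<in> arrows G" "\<d> w \<noteq> \<r> w" for w
      using f that by (auto simp: class_functions_def)
    have conj: "f (z \<cdot> w \<cdot> \<i> z) = f w"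
      if "w \<in> arrows G" "z \<in> arrows G" "\<d> w = \<r> w" "\<r> w = \<d> z" for w z
      using f that by (auto simp: class_functions_def)
    have "bij_betw (\<lambda>y. \<i> y \<cdot> x) ?P ?I"
    proof (rule bij_betw_byWitness[where f' = "\<lambda>z. x \<cdot> \<i> z"])
      show "\<forall>y\<in>?P. x \<cdot> \<i> (\<i> y \<cdot> x) = y"
        using x by (auto intro: div_ldiv_cancel)
      show "\<forall>z\<in>?I. \<i> (x \<cdot> \<i> z) \<cdot> x = z"
        using x by (auto intro: div_div_cancel)
      show "(\<lambda>y. \<i> y \<cdot> x) ` ?P \<subseteq> ?I"
        using x by (auto simp: ldiv_closed)
      show "(\<lambda>z. x \<cdot> \<i> z) ` ?I \<subseteq> ?P"
        using x by (auto simp: div_closed)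
    qed
    note reindex = sum'_reindex_bij_betw[OF this, of "\<lambda>z. g (x \<cdot> \<i> z) * f z"]
    \<comment> \<open>The arrow xy^{-1} goes from r(y) to r(x), so \<open>f\<close> vanishes on it
      unless \<open>y\<close> is parallel to \<open>x\<close>.\<close>
    have "sum' (\<lambda>y. f (x \<cdot> \<i> y) * g y) ?D = sum' (\<lambda>y. f (x \<cdot> \<i> y) * g y) ?P"
      by (rule sum.mono_neutral_right') (use x in \<open>auto simp: div_closed iso\<close>)
    also have "\<dots> = sum' (\<lambda>y. g (x \<cdot> \<i> (\<i> y \<cdot> x)) * f (\<i> y \<cdot> x)) ?P"
    proof (rule sum.cong')
      fix y assume y: "y \<in> ?P"
      \<comment> \<open>The argument on the left is xy^{-1}, here written as the conjugate by
        \<open>y\<close> of the isotropy arrow y^{-1}x.\<close>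
      have "f (y \<cdot> (\<i> y \<cdot> x) \<cdot> \<i> y) = f (\<i> y \<cdot> x)"
        by (rule conj) (use x y in \<open>auto simp: ldiv_closed\<close>)
      then show "f (x \<cdot> \<i> y) * g y = g (x \<cdot> \<i> (\<i> y \<cdot> x)) * f (\<i> y \<cdot> x)"
        using x y by (simp add: cancel_inv_left div_ldiv_cancel mult.commute)
    qed simp
    also have "\<dots> = sum' (\<lambda>z. g (x \<cdot> \<i> z) * f z) ?I"
      by (rule reindex)
    also have "\<dots> = sum' (\<lambda>z. g (x \<cdot> \<i> z) * f z) ?D"
    proof (rule sum.mono_neutral_left')
      show "\<forall>z\<in>?D - ?I. g (x \<cdot> \<i> z) * f z = 0"
      proof
        fix z assume "z \<in> ?D - ?I"
        then have "f z = 0" by (intro iso) auto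
        then show "g (x \<cdot> \<i> z) * f z = 0" by simp
      qed
    qed auto
    finally show ?thesis using x by (simp add: convolution_def)
  qed (simp add: convolution_def)
qed

section \<open>Convolution with the indicator of a slice\<close>

lemma convolution_indicator_right:
  fixes f :: "'g \<Rightarrow> 'k::{comm_ring,comm_monoid_mult}"
  assumes "slice G U" "x \<in> arrows G" "y \<in> U" "\<d> y = \<d> x"
  shows "convolution G f (\<lambda>x. if x \<in> U then 1 else 0) x = f (x \<cdot> \<i> y)"
proof -
  have sub: "U \<subseteq> arrows G" and inj: "inj_on \<d> U"
    using assms(1) openin_subset by (auto simp: slice_def arrows_def)
  have "sum' (\<lambda>y. f (x \<cdot> \<i> y) * (if y \<in> U then 1 else 0)) {y \<in> arrows G. \<d> y = \<d> x}
      = f (x \<cdot> \<i> y) * (if y \<in> U then 1 else 0)"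
  proof (rule sum'_eq_single)
    fix w assume w: "w \<in> {w \<in> arrows G. \<d> w = \<d> x}" "w \<noteq> y"
    \<comment> \<open>Injectivity of d on the slice leaves \<open>y\<close> as the only element of
      \<open>U\<close> in the fibre.\<close>
    then have "w \<notin> U" using inj_onD[OF inj, of w y] assms by auto
    then show "f (x \<cdot> \<i> w) * (if w \<in> U then 1 else 0) = 0" by simp
  qed (use assms sub in auto)
  then show ?thesis using assms by (simp add: convolution_def)
qed

text \<open>A term at w survives only if xw^{-1} lies in \<open>U\<close>. Its range is r(x), so
  injectivity of r on the slice forces xw^{-1} = y, that is, w = y^{-1}x.\<close>

lemma convolution_indicator_left:
  fixes f :: "'g \<Rightarrow> 'k::{comm_ring,comm_monoid_mult}"
  assumes "slice G U" "x \<in> arrows G" "y \<in> U" "\<r> y = \<r> x"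
  shows "convolution G (\<lambda>x. if x \<in> U then 1 else 0) f x = f (\<i> y \<cdot> x)"
proof -
  have y: "y \<in> arrows G" and inj: "inj_on \<r> U"
    using assms openin_subset by (auto simp: slice_def arrows_def)
  have eq: "w = \<i> y \<cdot> x" if w: "w \<in> arrows G" "\<d> w = \<d> x" "x \<cdot> \<i> w \<in> U" for w
  proof -
    have "x \<cdot> \<i> w = y"
      by (rule inj_onD[OF inj]) (use w assms in \<open>simp_all add: div_closed(3)\<close>)
    then show ?thesis using div_div_cancel[of x w] w assms by simp
  qed
  have "sum' (\<lambda>w. (if x \<cdot> \<i> w \<in> U then 1 else 0) * f w) {w \<in> arrows G. \<d> w = \<d> x}
      = (if x \<cdot> \<i> (\<i> y \<cdot> x) \<in> U then 1 else 0) * f (\<i> y \<cdot> x)"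
    by (rule sum'_eq_single) (use assms y eq in \<open>auto simp: ldiv_closed\<close>)
  then show ?thesis using assms y by (simp add: convolution_def div_ldiv_cancel)
qed

text \<open>Every xw^{-1} in the sum has range r(x), so none of them lies in
  \<open>U\<close>.\<close>

lemma convolution_indicator_left_zero:
  fixes f :: "'g \<Rightarrow> 'k::{comm_ring,comm_monoid_mult}"
  assumes "x \<in> arrows G" "\<r> x \<notin> \<r> ` U"
  shows "convolution G (\<lambda>x. if x \<in> U then 1 else 0) f x = 0"
proof -
  have "x \<cdot> \<i> w \<notin> U" if w: "w \<in> arrows G" "\<d> w = \<d> x" for w
  proof
    assume "x \<cdot> \<i> w \<in> U"
    then have "\<r> (x \<cdot> \<i> w) \<in> \<r> ` U" by (rule imageI)
    then show False using assms w by (simp add: div_closed(3))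
  qed
  then have "sum' (\<lambda>w. (if x \<cdot> \<i> w \<in> U then 1 else 0) * f w) {w \<in> arrows G. \<d> w = \<d> x}
      = sum' (\<lambda>w. 0) {w \<in> arrows G. \<d> w = \<d> x}"
    by (intro sum.cong') auto
  then show ?thesis by (simp add: convolution_def sum.G_def)
qed

end

text \<open>This allows compact slices consisting of units only to be chosen around a given
  unit.\<close>

lemma (in etale_groupoid) openin_unit_arrows: "openin (arrtop G) (unit_arrows G)"
proof (subst openin_subopen, intro ballI)
  fix u assume "u \<in> unit_arrows G"
  then have u: "u \<in> arrows G" "\<d> u = u"
    by (auto simp: unit_arrows_def dm_closed dm_dm)
  then obtain U where U: "openin (arrtop G) U" "u \<in> U"
    and hom: "homeomorphic_map (subtopology (arrtop G) U)
                (subtopology (unit_space G) (\<d> ` U)) \<d>"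
    using dm_local_homeomorphism by (auto simp: local_homeomorphism_map_def arrows_def)
  have sub: "U \<subseteq> arrows G" using U openin_subset by (auto simp: arrows_def)
  have inj: "inj_on \<d> U"
    using homeomorphic_imp_injective_map[OF hom] sub by (simp add: arrows_def Int_absorb1)
  have cont: "continuous_map (subtopology (arrtop G) U) (arrtop G) \<d>"
    using homeomorphic_imp_continuous_map[OF hom]
    by (simp add: unit_space_def continuous_map_in_subtopology)
  \<comment> \<open>For g in \<open>?W\<close>, both g and d(g) lie in \<open>U\<close> and have the
    same image under d. As d is injective on \<open>U\<close>, g = d(g) is a unit.\<close>
  let ?W = "{g \<in> U. \<d> g \<in> U}"
  have "topspace (subtopology (arrtop G) U) = U"
    using sub by (auto simp: arrows_def)
  then have "openin (subtopology (arrtop G) U) ?W"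
    using openin_continuous_map_preimage[OF cont U(1)] by simp
  then have "openin (arrtop G) ?W"
    using U(1) openin_trans_full by blast
  moreover have "?W \<subseteq> unit_arrows G"
  proof
    fix g assume g: "g \<in> ?W"
    have "g = \<d> g" by (rule inj_onD[OF inj]) (use g sub in \<open>auto simp: dm_dm\<close>)
    then show "g \<in> unit_arrows G" using g sub unfolding unit_arrows_def by blast
  qed
  moreover have "u \<in> ?W" using u U by simp
  ultimately show "\<exists>T. openin (arrtop G) T \<and> u \<in> T \<and> T \<subseteq> unit_arrows G" by blast
qed

section \<open>Central functions are class functions\<close>

context ample_groupoid
begin

lemma compact_slice_neighbourhood:
  assumes "openin (arrtop G) V" "x \<in> V"
  obtains U where "compact_slice G U" "x \<in> U" "U \<subseteq> V"
  using assms by (auto simp: compact_slices_basis union_of_def)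

lemma algebra_center_isotropy:
  fixes f :: "'a \<Rightarrow> 'k::{comm_ring,comm_monoid_mult}"
  assumes f: "f \<in> algebra_center G" and x: "x \<in> arrows G" "f x \<noteq> 0"
  shows "\<d> x = \<r> x"
proof (rule ccontr)
  assume ne: "\<d> x \<noteq> \<r> x"
  have ux: "\<d> x \<in> unit_arrows G" "\<r> x \<in> unit_arrows G"
    unfolding unit_arrows_def using x dm_rg[of x] rg_closed[of x]
    by (simp, metis imageI)
  have top: "topspace (unit_space G) = unit_arrows G"
    using openin_subset[OF openin_unit_arrows] by (auto simp: unit_space_def)
  \<comment> \<open>The Hausdorff property of the unit space separates d(x) from r(x); openness of
    the units then carries the neighbourhood over to the topology of arrows.\<close>
  have "closedin (unit_space G) {\<r> x}"
    using unit_space_Hausdorff ux top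
    by (simp add: closedin_Hausdorff_sing_eq)
  then have "openin (unit_space G) (unit_arrows G - {\<r> x})"
    using openin_diff[OF openin_topspace] top by metis
  then have "openin (arrtop G) (unit_arrows G - {\<r> x})"
    using openin_unit_arrows openin_trans_full unfolding unit_space_def by blast
  then obtain U where U: "compact_slice G U" "\<d> x \<in> U" "U \<subseteq> unit_arrows G - {\<r> x}"
    using compact_slice_neighbourhood[of _ "\<d> x"] ux ne by blast
  let ?e = "\<lambda>x. if x \<in> U then 1 else (0::'k)"
  \<comment> \<open>As r fixes units, its image of \<open>U\<close> is \<open>U\<close> itself,
    which misses r(x).\<close>
  have "\<r> u = u" if "u \<in> U" for u
    using that U(3) by (auto simp: unit_arrows_def rg_dm)
  then have "convolution G ?e f x = 0"
    using U(3) x by (intro convolution_indicator_left_zero) auto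
  moreover have "convolution G f ?e x = f (x \<cdot> \<i> (\<d> x))"
    using U x by (intro convolution_indicator_right) (auto simp: compact_slice_def dm_dm)
  moreover have "x \<cdot> \<i> (\<d> x) = x"
    using cancel_right[of x "\<d> x"] x by (simp add: composable_def dm_closed rg_dm cmp_dm)
  moreover have "convolution G f ?e = convolution G ?e f"
    using f indicator_compact_slice_in_groupoid_algebra[OF U(1)] by (auto simp: algebra_center_def)
  ultimately show False using x by simp
qed

lemma algebra_center_conjugation:
  fixes f :: "'a \<Rightarrow> 'k::{comm_ring,comm_monoid_mult}"
  assumes f: "f \<in> algebra_center G"
    and x: "x \<in> arrows G" "z \<in> arrows G" "\<d> x = \<r> x" "\<r> x = \<d> z"
  shows "f (z \<cdot> x \<cdot> \<i> z) = f x"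
proof -
  obtain U where U: "compact_slice G U" "z \<in> U"
    using compact_slice_neighbourhood[OF openin_topspace] x(2) unfolding arrows_def by blast
  let ?e = "\<lambda>x. if x \<in> U then 1 else (0::'k)"
  have zx: "(z, x) \<in> composable G" using x by (simp add: composable_def)
  \<comment> \<open>The same slice element \<open>z\<close> serves on both sides: d(zx) = d(x) =
    d(z), because \<open>x\<close> is an isotropy arrow at d(z), and r(zx) = r(z).\<close>
  have "f (z \<cdot> x \<cdot> \<i> z) = convolution G f ?e (z \<cdot> x)"
    by (rule convolution_indicator_right[symmetric])
      (use U zx x in \<open>auto simp: compact_slice_def cmp_closed dm_cmp\<close>)
  also have "\<dots> = convolution G ?e f (z \<cdot> x)"
    using f indicator_compact_slice_in_groupoid_algebra[OF U(1)] by (auto simp: algebra_center_def)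
  also have "\<dots> = f (\<i> z \<cdot> (z \<cdot> x))"
    by (rule convolution_indicator_left)
      (use U zx in \<open>auto simp: compact_slice_def cmp_closed rg_cmp\<close>)
  also have "\<dots> = f x" using zx by (simp add: cancel_left)
  finally show ?thesis .
qed

end

theorem proposition3p14:
  fixes G :: "'g groupoid_data"
  assumes "ample_groupoid G"
  shows "(algebra_center G :: ('g \<Rightarrow> 'k::{comm_ring,comm_monoid_mult}) set) = class_functions G"
proof -
  interpret ample_groupoid G by fact
  show ?thesis
  proof (intro equalityI subsetI)
    fix f :: "'g \<Rightarrow> 'k" assume f: "f \<in> algebra_center G"
    then show "f \<in> class_functions G"
      using algebra_center_isotropy[OF f] algebra_center_conjugation[OF f]
      by (auto simp: class_functions_def algebra_center_def)
  next
    fix f :: "'g \<Rightarrow> 'k" assume "f \<in> class_functions G"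
    then show "f \<in> algebra_center G"
      using convolution_class_function_commute
      by (auto simp: algebra_center_def class_functions_def)
  qed
qed

end
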